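(* Let $\kappa<\mu\le\lambda$ be infinite cardinals with $\kappa$ and $\mu$ regular, and let $\pi$ be an automorphism of $\mathcal{P}(\lambda)/\mathcal{I}_\kappa$. Suppose that either $\pi$ is cardinality-preserving or $\mu>\kappa^+$. If the induced automorphism $\pi_\mu$ of $\mathcal{P}(\lambda)/\mathcal{I}_\mu$ is trivial, then $\pi$ is $\mu$-almost trivial, i.e. there are $T,S\subseteq\lambda$ with $\lambda=T\cup S$, $|S|<\mu$, and $\pi$ trivial on $T$.
   Context: $\mathcal{I}_\kappa$ is the ideal of subsets of $\lambda$ of cardinality less than $\kappa$; $[A]$ is the class of $A$. A selector for $\pi$ is a map $\pi^*:\mathcal{P}(\lambda)\to\mathcal{P}(\lambda)$ with $\pi([A])=[\pi^*(A)]$ for all $A$. $\pi$ is cardinality-preserving if for every $A\subseteq\lambda$ there is $B$ with $|B|=|A|$ and $\pi([A])=[B]$. Under the hypotheses, $\pi_\mu([A]_{\mathcal{I}_\mu})=[\pi^*(A)]_{\mathcal{I}_\mu}$ is a well-defined automorphism of $\mathcal{P}(\lambda)/\mathcal{I}_\mu$ for any selector $\pi^*$. An automorphism $\pi$ of $\mathcal{P}(\lambda)/\mathcal{I}$ is trivial if there is $f:\lambda\to\lambda$ with $\pi([A])=[f^{-1}(A)]$ for all $A\subseteq\lambda$; $\pi$ is trivial on $Z\subseteq\lambda$ if there is $f:\lambda\to Z$ with $\pi([A])=[f^{-1}(A)]$ for all $A\subseteq Z$ (equivalently $f$ may be defined on a subset of $\lambda$ with complement in the ideal).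
   Formalization: "π trivial on Z" is taken with f: D→Z for some D⊆λ (necessarily [D]=π([Z])) instead of f: λ→Z; the literal form forces |λ∖Z|<κ, and the claim then fails under CH for κ=ω, μ=λ=ω₁. *)

theory Defs
  imports "HOL-Library.FuncSet"
begin

unbundle cardinal_syntax

definition small_ideal :: "'a set \<Rightarrow> 'k rel \<Rightarrow> 'a set set" where
  "small_ideal L \<kappa> = {A. A \<subseteq> L \<and> |A| <o \<kappa>}"

definition ideal_rel :: "'a set \<Rightarrow> 'a set set \<Rightarrow> 'a set rel" where
  "ideal_rel L I = {(A, B). A \<subseteq> L \<and> B \<subseteq> L \<and> sym_diff A B \<in> I}"

definition cls :: "'a set \<Rightarrow> 'a set set \<Rightarrow> 'a set \<Rightarrow> 'a set set" where
  "cls L I A = ideal_rel L I `` {A}"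

definition quot :: "'a set \<Rightarrow> 'a set set \<Rightarrow> 'a set set set" where
  "quot L I = Pow L // ideal_rel L I"

definition quot_join ::
  "'a set \<Rightarrow> 'a set set \<Rightarrow> 'a set set \<Rightarrow> 'a set set \<Rightarrow> 'a set set" where
  "quot_join L I X Y = (\<Union>A\<in>X. \<Union>B\<in>Y. cls L I (A \<union> B))"

definition quot_meet ::
  "'a set \<Rightarrow> 'a set set \<Rightarrow> 'a set set \<Rightarrow> 'a set set \<Rightarrow> 'a set set" where
  "quot_meet L I X Y = (\<Union>A\<in>X. \<Union>B\<in>Y. cls L I (A \<inter> B))"

definition quot_compl :: "'a set \<Rightarrow> 'a set set \<Rightarrow> 'a set set \<Rightarrow> 'a set set" where
  "quot_compl L I X = (\<Union>A\<in>X. cls L I (L - A))"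

definition automorphism ::
  "'a set \<Rightarrow> 'a set set \<Rightarrow> ('a set set \<Rightarrow> 'a set set) \<Rightarrow> bool" where
  "automorphism L I \<pi> \<longleftrightarrow>
     bij_betw \<pi> (quot L I) (quot L I) \<and>
     (\<forall>X\<in>quot L I. \<forall>Y\<in>quot L I. \<pi> (quot_join L I X Y) = quot_join L I (\<pi> X) (\<pi> Y)) \<and>
     (\<forall>X\<in>quot L I. \<forall>Y\<in>quot L I. \<pi> (quot_meet L I X Y) = quot_meet L I (\<pi> X) (\<pi> Y)) \<and>
     (\<forall>X\<in>quot L I. \<pi> (quot_compl L I X) = quot_compl L I (\<pi> X)) \<and>
     \<pi> (cls L I {}) = cls L I {} \<and>
     \<pi> (cls L I L) = cls L I L"

definition selector ::
  "'a set \<Rightarrow> 'a set set \<Rightarrow> ('a set set \<Rightarrow> 'a set set) \<Rightarrow> ('a set \<Rightarrow> 'a set) \<Rightarrow> bool" where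
  "selector L I \<pi> \<sigma> \<longleftrightarrow> \<sigma> \<in> Pow L \<rightarrow> Pow L \<and> (\<forall>A\<subseteq>L. \<pi> (cls L I A) = cls L I (\<sigma> A))"

definition cardinality_preserving ::
  "'a set \<Rightarrow> 'a set set \<Rightarrow> ('a set set \<Rightarrow> 'a set set) \<Rightarrow> bool" where
  "cardinality_preserving L I \<pi> \<longleftrightarrow>
     (\<forall>A\<subseteq>L. \<exists>B\<subseteq>L. |B| =o |A| \<and> \<pi> (cls L I A) = cls L I B)"

text \<open>
  The map on classes modulo a (larger) ideal \<open>J\<close> sending \<open>cls L J A\<close> to \<open>cls L J (\<sigma> A)\<close>.
  As for the operations above, the union runs over all representatives; it is the common value
  whenever the class of \<open>\<sigma> A\<close> does not depend on the representative \<open>A\<close>.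
\<close>

definition induced_map ::
  "'a set \<Rightarrow> 'a set set \<Rightarrow> ('a set \<Rightarrow> 'a set) \<Rightarrow> 'a set set \<Rightarrow> 'a set set" where
  "induced_map L J \<sigma> X = (\<Union>A\<in>X. cls L J (\<sigma> A))"

definition trivial_aut ::
  "'a set \<Rightarrow> 'a set set \<Rightarrow> ('a set set \<Rightarrow> 'a set set) \<Rightarrow> bool" where
  "trivial_aut L I \<pi> \<longleftrightarrow>
     (\<exists>f. f \<in> L \<rightarrow> L \<and> (\<forall>A\<subseteq>L. \<pi> (cls L I A) = cls L I (f -` A \<inter> L)))"

text \<open>
  The witness for triviality on \<open>Z\<close> is a function into \<open>Z\<close> defined on a subset \<open>D\<close> of \<open>L\<close>.
  Taking \<open>A = Z\<close> shows that \<open>D\<close> is necessarily a representative of the image of the class of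
  \<open>Z\<close>. The domain cannot be required to be all of \<open>L\<close>, not even up to the ideal: that would
  force \<open>Z\<close> itself to have complement in the ideal.
\<close>

definition trivial_on ::
  "'a set \<Rightarrow> 'a set set \<Rightarrow> ('a set set \<Rightarrow> 'a set set) \<Rightarrow> 'a set \<Rightarrow> bool" where
  "trivial_on L I \<pi> Z \<longleftrightarrow>
     (\<exists>D f. D \<subseteq> L \<and> f \<in> D \<rightarrow> Z \<and> (\<forall>A\<subseteq>Z. \<pi> (cls L I A) = cls L I (f -` A \<inter> D)))"

definition almost_trivial ::
  "'a set \<Rightarrow> 'a set set \<Rightarrow> 'm rel \<Rightarrow> ('a set set \<Rightarrow> 'a set set) \<Rightarrow> bool" where
  "almost_trivial L I \<mu> \<pi> \<longleftrightarrow>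
     (\<exists>T S. T \<subseteq> L \<and> S \<subseteq> L \<and> L = T \<union> S \<and> |S| <o \<mu> \<and> trivial_on L I \<pi> T)"

lemma small_Un:
  assumes "Cinfinite \<kappa>" "|A| <o \<kappa>" "|B| <o \<kappa>"
  shows "|A \<union> B| <o \<kappa>"
  using assms card_of_Un_ordLess_infinite_Field unfolding cinfinite_def by blast

lemma equiv_ideal_rel:
  assumes "Cinfinite \<kappa>"
  shows "equiv (Pow L) (ideal_rel L (small_ideal L \<kappa>))"
proof (rule equivI)
  have em: "|{}| <o \<kappa>"
    by (rule Cfinite_ordLess_Cinfinite) (use assms in \<open>simp_all add: cfinite_def Field_card_of card_of_card_order_on\<close>)
  show "ideal_rel L (small_ideal L \<kappa>) \<subseteq> Pow L \<times> Pow L"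
    by (auto simp: ideal_rel_def)
  show "refl_on (Pow L) (ideal_rel L (small_ideal L \<kappa>))"
    using em by (auto simp: refl_on_def ideal_rel_def small_ideal_def)
  show "sym (ideal_rel L (small_ideal L \<kappa>))"
    by (auto simp: sym_def ideal_rel_def small_ideal_def Un_commute)
  show "trans (ideal_rel L (small_ideal L \<kappa>))"
  proof (rule transI)
    fix A B C
    assume 1: "(A, B) \<in> ideal_rel L (small_ideal L \<kappa>)" "(B, C) \<in> ideal_rel L (small_ideal L \<kappa>)"
    have "|sym_diff A C| \<le>o |sym_diff A B \<union> sym_diff B C|"
      by (rule card_of_mono1) auto
    moreover have "|sym_diff A B \<union> sym_diff B C| <o \<kappa>"
      by (rule small_Un[OF assms(1)]) (use 1 in \<open>auto simp: ideal_rel_def small_ideal_def\<close>)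
    ultimately have "|sym_diff A C| <o \<kappa>" by (rule ordLeq_ordLess_trans)
    then show "(A, C) \<in> ideal_rel L (small_ideal L \<kappa>)"
      using 1 by (auto simp: ideal_rel_def small_ideal_def)
  qed
qed

lemma quot_compl_cls:
  assumes "Cinfinite \<kappa>" "A \<subseteq> L"
  shows "quot_compl L (small_ideal L \<kappa>) (cls L (small_ideal L \<kappa>) A) =
    cls L (small_ideal L \<kappa>) (L - A)"
proof -
  let ?R = "ideal_rel L (small_ideal L \<kappa>)"
  have "(L - B, L - C) \<in> ?R" if "(B, C) \<in> ?R" for B C
  proof -
    have "sym_diff (L - B) (L - C) = sym_diff B C"
      using that by (auto simp: ideal_rel_def)
    then show ?thesis using that by (auto simp: ideal_rel_def)
  qed
  then have "(\<lambda>B. ?R `` {L - B}) respects ?R"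
    by (intro congruentI equiv_class_eq[OF equiv_ideal_rel[OF assms(1)]])
  then show ?thesis
    using UN_equiv_class[OF equiv_ideal_rel[OF assms(1)]] assms(2)
    by (simp add: quot_compl_def cls_def)
qed

lemma quot_binop_cls:
  assumes "Cinfinite \<kappa>" "A \<subseteq> L" "B \<subseteq> L"
  shows "quot_join L (small_ideal L \<kappa>) (cls L (small_ideal L \<kappa>) A) (cls L (small_ideal L \<kappa>) B) =
      cls L (small_ideal L \<kappa>) (A \<union> B)"
    and "quot_meet L (small_ideal L \<kappa>) (cls L (small_ideal L \<kappa>) A) (cls L (small_ideal L \<kappa>) B) =
      cls L (small_ideal L \<kappa>) (A \<inter> B)"
proof -
  let ?R = "ideal_rel L (small_ideal L \<kappa>)"
  note eq = equiv_ideal_rel[OF assms(1)]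
  have small: "|X| <o \<kappa>"
    if "(C, C') \<in> ?R" "(D, D') \<in> ?R" "X \<subseteq> sym_diff C C' \<union> sym_diff D D'" for C C' D D' X
  proof -
    have "|sym_diff C C' \<union> sym_diff D D'| <o \<kappa>"
      by (rule small_Un[OF assms(1)]) (use that in \<open>auto simp: ideal_rel_def small_ideal_def\<close>)
    with card_of_mono1[OF that(3)] show ?thesis by (rule ordLeq_ordLess_trans)
  qed
  have "(C \<union> D, C' \<union> D') \<in> ?R" if "(C, C') \<in> ?R" "(D, D') \<in> ?R" for C C' D D'
  proof -
    have "|sym_diff (C \<union> D) (C' \<union> D')| <o \<kappa>" by (rule small[OF that]) auto
    then show ?thesis using that by (auto simp: ideal_rel_def small_ideal_def)
  qed
  then have "(\<lambda>C D. ?R `` {C \<union> D}) respects2 ?R"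
    by (intro congruent2I' equiv_class_eq[OF eq])
  then show "quot_join L (small_ideal L \<kappa>) (cls L (small_ideal L \<kappa>) A) (cls L (small_ideal L \<kappa>) B) =
      cls L (small_ideal L \<kappa>) (A \<union> B)"
    using UN_equiv_class2[OF eq eq] assms by (simp add: quot_join_def cls_def)
  have "(C \<inter> D, C' \<inter> D') \<in> ?R" if "(C, C') \<in> ?R" "(D, D') \<in> ?R" for C C' D D'
  proof -
    have "|sym_diff (C \<inter> D) (C' \<inter> D')| <o \<kappa>" by (rule small[OF that]) auto
    then show ?thesis using that by (auto simp: ideal_rel_def small_ideal_def)
  qed
  then have "(\<lambda>C D. ?R `` {C \<inter> D}) respects2 ?R"
    by (intro congruent2I' equiv_class_eq[OF eq])
  then show "quot_meet L (small_ideal L \<kappa>) (cls L (small_ideal L \<kappa>) A) (cls L (small_ideal L \<kappa>) B) =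
      cls L (small_ideal L \<kappa>) (A \<inter> B)"
    using UN_equiv_class2[OF eq eq] assms by (simp add: quot_meet_def cls_def)
qed

lemma induced_map_cls:
  assumes "Cinfinite \<mu>" "A \<subseteq> L"
    and "\<And>B C. B \<subseteq> L \<Longrightarrow> C \<subseteq> L \<Longrightarrow> cls L (small_ideal L \<mu>) B = cls L (small_ideal L \<mu>) C \<Longrightarrow>
      cls L (small_ideal L \<mu>) (\<sigma> B) = cls L (small_ideal L \<mu>) (\<sigma> C)"
  shows "induced_map L (small_ideal L \<mu>) \<sigma> (cls L (small_ideal L \<mu>) A) =
    cls L (small_ideal L \<mu>) (\<sigma> A)"
proof -
  let ?R = "ideal_rel L (small_ideal L \<mu>)"
  note eq = equiv_ideal_rel[OF assms(1)]
  have "(\<lambda>B. ?R `` {\<sigma> B}) respects ?R"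
    by (intro congruentI assms(3)[unfolded cls_def] equiv_class_eq[OF eq])
      (auto simp: ideal_rel_def)
  then show ?thesis
    using UN_equiv_class[OF eq] assms(2) by (simp add: induced_map_def cls_def)
qed

end

theory Submission
  imports Defs
begin

text \<open>
  Let \<open>f\<close> induce \<open>\<pi>\<^sub>\<mu>\<close>. Wherever \<open>f\<close> does not induce \<open>\<pi>\<close> modulo sets of size less than
  \<open>\<kappa>\<close>, there are sets \<open>X\<close> and \<open>Y\<close> of size \<open>\<kappa>\<close> with \<open>[Y] \<le> \<pi>[X]\<close> but \<open>f ` Y\<close> disjoint from
  \<open>X\<close>. Independent pairs of this kind add up, so there are fewer than \<open>\<mu>\<close> of them in a maximal
  family, and removing that family leaves a set on which \<open>f\<close> induces \<open>\<pi>\<close>.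

  The removal needs that \<open>\<pi>\<inverse>\<close> preserves sets of size less than \<open>\<mu>\<close>. Without
  cardinality preservation this is a Balcar--Frankiewicz argument: an isomorphism between
  \<open>P(\<kappa>)\<close> and \<open>P(\<theta>)\<close> modulo \<open>\<kappa>\<close>-small sets, for regular \<open>\<theta> > \<kappa>\<close>, gives a \<open>\<theta>\<close>-scale
  in the functions from \<open>\<kappa>\<close> to \<open>\<kappa>\<close>, and there cannot be scales of both lengths \<open>\<kappa>\<^sup>+\<close> and \<open>\<kappa>\<^sup>+\<^sup>+\<close>.
\<close>

section \<open>Cardinal arithmetic: subsets, unions, initial segments, regularity\<close>

lemma subset_of_cardinality:
  assumes "Card_order r" "r \<le>o |X|"
  obtains Y where "Y \<subseteq> X" "|Y| =o r"
proof -
  have "|Field r| \<le>o |X|"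
    using card_of_Field_ordIso[OF assms(1)] assms(2) by (rule ordIso_ordLeq_trans)
  then obtain g where g: "inj_on g (Field r)" "g ` Field r \<subseteq> X"
    by (auto simp flip: card_of_ordLeq)
  have "|g ` Field r| =o |Field r|"
    using g(1) by (meson bij_betw_imageI card_of_ordIso ordIso_symmetric)
  then have "|g ` Field r| =o r"
    using card_of_Field_ordIso[OF assms(1)] ordIso_transitive by blast
  with g(2) that show thesis by blast
qed

lemma subset_card_less: "|B| <o r \<Longrightarrow> A \<subseteq> B \<Longrightarrow> |A| <o r"
  using card_of_mono1 ordLeq_ordLess_trans by blast

lemma card_not_less_iff: "Card_order r \<Longrightarrow> \<not> |A| <o r \<longleftrightarrow> r \<le>o |A|"
  by (meson card_of_Well_order card_order_on_well_order_on not_ordLess_iff_ordLeq)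

lemma card_not_leq_iff: "Card_order r \<Longrightarrow> \<not> |A| \<le>o r \<longleftrightarrow> r <o |A|"
  by (meson card_of_Well_order card_order_on_well_order_on not_ordLeq_iff_ordLess)

lemma Cinfinite_infinite_Field: "Cinfinite r \<Longrightarrow> infinite (Field r)"
  by (simp add: cinfinite_def)

text \<open>The union has size at most \<open>|I|\<close> plus \<kappa>, and both summands lie below
  \<mu>.\<close>

lemma card_of_UNION_ordLess:
  assumes "Cinfinite \<kappa>" "Cinfinite \<mu>" "\<kappa> <o \<mu>" "|I| <o \<mu>" "\<And>i. i \<in> I \<Longrightarrow> |A i| \<le>o \<kappa>"
  shows "|\<Union>i\<in>I. A i| <o \<mu>"
proof -
  have eq: "|Field \<kappa>| =o \<kappa>" using assms(1) card_of_Field_ordIso by blast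
  have "|\<Union>i\<in>I. A i| \<le>o |I <+> Field \<kappa>|"
  proof (rule card_of_UNION_ordLeq_infinite)
    show "infinite (I <+> Field \<kappa>)" using assms(1) by (simp add: cinfinite_def)
    show "\<forall>i\<in>I. |A i| \<le>o |I <+> Field \<kappa>|"
      using assms(5) eq card_of_Plus2 by (meson ordIso_symmetric ordLeq_ordIso_trans ordLeq_transitive)
  qed (rule card_of_Plus1)
  also have "|I <+> Field \<kappa>| <o \<mu>"
    using assms eq by (intro card_of_Plus_ordLess_infinite_Field) (auto simp: cinfinite_def intro: ordIso_ordLess_trans)
  finally show ?thesis .
qed

text \<open>If \<open>Z\<close> had more than \<kappa> elements, the restriction of \<open>r\<close>
  to \<open>Z\<close> would be longer than \<kappa> and hence have a proper initial segment of order
  type \<kappa>, which is not of size less than \<kappa>.\<close>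

lemma card_of_leq_if_initial_segments_less:
  assumes "Card_order \<kappa>" "Well_order r" "Z \<subseteq> Field r"
    and small: "\<And>a. a \<in> Z \<Longrightarrow> |Z \<inter> underS r a| <o \<kappa>"
  shows "|Z| \<le>o \<kappa>"
proof (rule ccontr)
  assume "\<not> |Z| \<le>o \<kappa>"
  then have less: "\<kappa> <o |Z|" by (simp add: assms(1) card_not_leq_iff)
  let ?s = "Restr r Z"
  have W: "well_order_on Z ?s" by (rule well_order_on_Restr[OF assms(2,3)])
  then have F: "Field ?s = Z" by (metis well_order_on_Field)
  have "|Z| \<le>o ?s" using W by (rule card_of_least)
  with less have "\<kappa> <o ?s" by (rule ordLess_ordLeq_trans)
  moreover have "Well_order ?s" using W F by simp
  ultimately obtain a where a: "a \<in> Z" and iso: "\<kappa> =o Restr ?s (underS ?s a)"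
    using ordLess_iff_ordIso_Restr[of ?s \<kappa>] F card_order_on_well_order_on[OF assms(1)] by auto
  let ?p = "Restr ?s (underS ?s a)"
  have "Card_order ?p" using iso assms(1) Card_order_ordIso2 by blast
  then have "|Field ?p| =o ?p" by (rule card_of_Field_ordIso)
  then have eq: "|Field ?p| =o \<kappa>" using iso ordIso_symmetric ordIso_transitive by blast
  have "Field ?p \<subseteq> Z \<inter> underS r a" by (auto simp: Field_def underS_def)
  then have "|Field ?p| <o \<kappa>" using small[OF a] subset_card_less by blast
  with eq show False using not_ordLess_ordIso by blast
qed

lemma card_of_under_less:
  assumes "Cinfinite r" "a \<in> Field r"
  shows "|under r a| <o r"
proof -
  have "|underS r a| <o r" using conjunct2[OF assms(1)] assms(2) by (rule card_of_underS)
  moreover have "|{a}| <o r"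
    by (rule Cfinite_ordLess_Cinfinite) (use assms in \<open>simp_all add: cfinite_def Field_card_of card_of_card_order_on\<close>)
  ultimately have "|underS r a \<union> {a}| <o r" by (rule small_Un[OF assms(1)])
  then show ?thesis by (rule subset_card_less) (auto simp: under_def underS_def)
qed

text \<open>By regularity \<open>K\<close> is too small to be cofinal; totality turns an element
  with nothing of \<open>K\<close> above it into an upper bound.\<close>

lemma regularCard_bounded:
  assumes "Cinfinite r" "regularCard r" "K \<subseteq> Field r" "|K| <o r"
  obtains a where "a \<in> Field r" "K \<subseteq> under r a"
proof -
  have "\<not> |K| =o r" using assms(4) not_ordLess_ordIso by blast
  then have "\<not> cofinal K r" using assms(2,3) unfolding regularCard_def by blast
  then obtain a where a: "a \<in> Field r" "\<And>b. b \<in> K \<Longrightarrow> a = b \<or> (a, b) \<notin> r"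
    unfolding cofinal_def by blast
  have W: "wo_rel r" using assms(1) by (simp add: wo_rel_def card_order_on_well_order_on)
  have "K \<subseteq> under r a"
    using a assms(3) wo_rel.TOTALS[OF W] wo_rel.REFL[OF W]
    by (auto simp: under_def refl_on_def)
  with a(1) that show thesis by blast
qed

section \<open>Automorphisms modulo small sets, in terms of representatives\<close>

text \<open>This is what a selector inherits from an automorphism: a Boolean homomorphism up to sets
  of size less than \<kappa>, with \<open>null_iff\<close> expressing injectivity and
  \<open>surj\<close> surjectivity. Order relations in the quotient become smallness of differences
  of sets.\<close>

locale boolean_lift =
  fixes L :: "'a set" and \<kappa> :: "'k rel" and \<sigma> :: "'a set \<Rightarrow> 'a set"
  assumes cinf: "Cinfinite \<kappa>" and reg: "regularCard \<kappa>"
    and range: "A \<subseteq> L \<Longrightarrow> \<sigma> A \<subseteq> L"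
    and meet: "A \<subseteq> L \<Longrightarrow> B \<subseteq> L \<Longrightarrow> |sym_diff (\<sigma> (A \<inter> B)) (\<sigma> A \<inter> \<sigma> B)| <o \<kappa>"
    and diff: "A \<subseteq> L \<Longrightarrow> B \<subseteq> L \<Longrightarrow> |sym_diff (\<sigma> (A - B)) (\<sigma> A - \<sigma> B)| <o \<kappa>"
    and null_iff: "A \<subseteq> L \<Longrightarrow> |\<sigma> A| <o \<kappa> \<longleftrightarrow> |A| <o \<kappa>"
    and surj: "B \<subseteq> L \<Longrightarrow> \<exists>A\<subseteq>L. |sym_diff (\<sigma> A) B| <o \<kappa>"
begin

abbreviation small :: "'x set \<Rightarrow> bool" where "small X \<equiv> |X| <o \<kappa>"

lemma card: "Card_order \<kappa>" using cinf by blast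

lemma small_empty: "small {}"
  by (rule Cfinite_ordLess_Cinfinite) (use cinf in \<open>simp_all add: cfinite_def Field_card_of card_of_card_order_on\<close>)

lemma small_cover: "small P \<Longrightarrow> small Q \<Longrightarrow> X \<subseteq> P \<union> Q \<Longrightarrow> small X"
  by (rule subset_card_less[OF small_Un[OF cinf]])

lemma small_leq: "small X \<Longrightarrow> |X| \<le>o \<kappa>"
  by (rule ordLess_imp_ordLeq)

lemma mono: "A \<subseteq> B \<Longrightarrow> B \<subseteq> L \<Longrightarrow> small (\<sigma> A - \<sigma> B)"
  using meet[of A B] by (rule subset_card_less) (auto simp: Int_absorb2)

lemma disjoint:
  assumes "A \<subseteq> L" "B \<subseteq> L" "A \<inter> B = {}"
  shows "small (\<sigma> A \<inter> \<sigma> B)"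
proof -
  have "small (\<sigma> {})" using null_iff[of "{}"] small_empty by simp
  from this meet[OF assms(1,2)] show ?thesis by (rule small_cover) (auto simp: assms(3))
qed

text \<open>Any preimage of \<open>B\<close> can be intersected with \<open>A\<close>, because
  \<open>B\<close> lies in \<open>\<sigma> A\<close> up to a small set.\<close>

lemma surj_below:
  assumes "A \<subseteq> L" "B \<subseteq> L" "small (B - \<sigma> A)"
  obtains X where "X \<subseteq> A" "small (sym_diff (\<sigma> X) B)"
proof -
  from surj[OF assms(2)] obtain X where X: "X \<subseteq> L" "small (sym_diff (\<sigma> X) B)" by blast
  have "small (sym_diff (\<sigma> X) B \<union> (B - \<sigma> A))"
    using X(2) assms(3) by (rule small_Un[OF cinf])
  from this meet[OF X(1) assms(1)] have "small (sym_diff (\<sigma> (X \<inter> A)) B)"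
    by (rule small_cover) blast
  with that show thesis by blast
qed

lemma small_sym_diff_card_less:
  assumes "Cinfinite \<mu>" "\<kappa> <o \<mu>" "|B| <o \<mu>" "small (sym_diff A B)"
  shows "|A| <o \<mu>"
proof -
  have "|sym_diff A B| <o \<mu>" using assms(4,2) ordLess_transitive by blast
  then have "|sym_diff A B \<union> B| <o \<mu>" using assms(3) by (rule small_Un[OF assms(1)])
  then show ?thesis by (rule subset_card_less) blast
qed

section \<open>Scales of functions from \<kappa> to \<kappa>\<close>

text \<open>The condition \<open>(h n, g n) \<in> \<kappa>\<close> reads h(n) \<le> g(n), so
  \<open>h\<close> strictly exceeds \<open>g\<close> off a small set. One \<open>h\<close> has to
  dominate a whole family of fewer than \<theta> functions; this is what makes scales of two
  different lengths incompatible.\<close>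

definition is_scale :: "'t rel \<Rightarrow> ('k \<Rightarrow> 'k) set \<Rightarrow> bool" where
  "is_scale \<theta> H \<longleftrightarrow> |H| \<le>o \<theta> \<and> H \<subseteq> Field \<kappa> \<rightarrow> Field \<kappa> \<and>
     (\<forall>G \<subseteq> Field \<kappa> \<rightarrow> Field \<kappa>. |G| <o \<theta> \<longrightarrow>
       (\<exists>h\<in>H. \<forall>g\<in>G. small {n \<in> Field \<kappa>. (h n, g n) \<in> \<kappa>}))"

text \<open>
  A set of regular size \<open>\<theta> > \<kappa>\<close> whose image has size at most \<open>\<kappa>\<close> is laid out as
  \<open>\<kappa> \<times> \<theta>\<close>. The images \<open>V n\<close> of the columns partition a set of size \<open>\<kappa>\<close>; the part of
  \<open>\<Union>n. V n\<close> below the graph of a function \<open>g\<close> meets each \<open>V n\<close> in a small set, so it comes from a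
  set of size at most \<open>\<kappa>\<close>, which lies in \<open>\<kappa> \<times> \<alpha>\<close> for some \<open>\<alpha> < \<theta>\<close>. Any choice of points of
  \<open>V n\<close> outside the image of \<open>\<kappa> \<times> \<alpha>\<close> then dominates \<open>g\<close>.
\<close>

lemma ex_is_scale:
  fixes \<theta> :: "'t rel"
  assumes "Cinfinite \<theta>" "regularCard \<theta>" "\<kappa> <o \<theta>" "Y \<subseteq> L" "|Y| =o \<theta>" "|\<sigma> Y| \<le>o \<kappa>"
  shows "\<exists>H. is_scale \<theta> H"
proof -
  have cardt: "Card_order \<theta>" using assms(1) by blast
  have fk: "|Field \<kappa>| =o \<kappa>" and ft: "|Field \<theta>| =o \<theta>"
    using card cardt card_of_Field_ordIso by blast+
  have wo: "wo_rel \<kappa>" using card by (simp add: wo_rel_def card_order_on_well_order_on)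
  have ne: "Field \<kappa> \<noteq> {}" using Cinfinite_infinite_Field[OF cinf] by auto
  have "|Field \<kappa>| \<le>o |Field \<theta>|"
    using fk ft assms(3) by (meson ordIso_ordLeq_trans ordIso_symmetric ordLeq_ordIso_trans ordLess_imp_ordLeq)
  then have "|Field \<kappa> \<times> Field \<theta>| =o |Field \<theta>|"
    using ne Cinfinite_infinite_Field[OF assms(1)] by (intro card_of_Times_infinite_simps)
  then have "|Field \<kappa> \<times> Field \<theta>| =o |Y|"
    using ft assms(5) by (meson ordIso_symmetric ordIso_transitive)
  then obtain e where e: "bij_betw e (Field \<kappa> \<times> Field \<theta>) Y"
    using card_of_ordIso by blast
  then have inje: "inj_on e (Field \<kappa> \<times> Field \<theta>)" and ime: "e ` (Field \<kappa> \<times> Field \<theta>) = Y"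
    by (auto simp: bij_betw_def)
  have "|\<sigma> Y| \<le>o |Field \<kappa>|" using assms(6) fk ordIso_symmetric ordLeq_ordIso_trans by blast
  then obtain j where j: "inj_on j (\<sigma> Y)" "j ` \<sigma> Y \<subseteq> Field \<kappa>"
    by (auto simp flip: card_of_ordLeq)
  \<comment> \<open>\<open>C n\<close> is the copy in \<open>Y\<close> of the column over
    \<open>n\<close>, and \<open>R a\<close> that of the rectangle of all columns up to height
    \<open>a\<close>. Subtracting the earlier columns makes the \<open>V n\<close> disjoint;
    intersecting with \<open>\<sigma> Y\<close> puts them into the domain of
    \<open>j\<close>.\<close>
  define C where "C n = e ` ({n} \<times> Field \<theta>)" for n
  define R where "R a = e ` (Field \<kappa> \<times> under \<theta> a)" for a
  define V where "V n = (\<sigma> (C n) \<inter> \<sigma> Y) - (\<Union>m\<in>underS \<kappa> n. \<sigma> (C m))" for n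
  have CY: "C n \<subseteq> Y" if "n \<in> Field \<kappa>" for n using that ime unfolding C_def by blast
  have CL: "C n \<subseteq> L" if "n \<in> Field \<kappa>" for n using CY[OF that] assms(4) by blast
  have under: "under \<theta> a \<subseteq> Field \<theta>" for a by (auto simp: under_def Field_def)
  have RY: "R a \<subseteq> Y" for a using ime under unfolding R_def by blast
  then have RL: "R a \<subseteq> L" for a using assms(4) by blast
  have C_disj: "C m \<inter> C n = {}" if "m \<in> Field \<kappa>" "n \<in> Field \<kappa>" "m \<noteq> n" for m n
    using that inje unfolding C_def inj_on_def by blast
  have V_disj: "m = n" if "x \<in> V m" "x \<in> V n" "m \<in> Field \<kappa>" "n \<in> Field \<kappa>" for m n x
  proof (rule ccontr)
    assume "m \<noteq> n"
    then have "m \<in> underS \<kappa> n \<or> n \<in> underS \<kappa> m"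
      using wo_rel.TOTALS[OF wo] that(3,4) by (auto simp: underS_def)
    then show False using that(1,2) unfolding V_def by blast
  qed
  \<comment> \<open>Fewer than \<kappa> columns precede \<open>n\<close>, each with image almost
    disjoint from that of \<open>C n\<close>, so regularity of \<kappa> keeps the removed part
    small.\<close>
  have V_eq: "small (\<sigma> (C n) - V n)" if n: "n \<in> Field \<kappa>" for n
  proof -
    have "small (\<Union>m\<in>underS \<kappa> n. \<sigma> (C m) \<inter> \<sigma> (C n))"
    proof (rule card_of_UNION_ordLess_infinite_Field_regularCard[OF reg cinf])
      show "small (underS \<kappa> n)" using card n by (rule card_of_underS)
      show "\<forall>m\<in>underS \<kappa> n. small (\<sigma> (C m) \<inter> \<sigma> (C n))"
      proof
        fix m assume "m \<in> underS \<kappa> n"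
        then have "m \<in> Field \<kappa>" "m \<noteq> n" by (auto simp: underS_def Field_def)
        then show "small (\<sigma> (C m) \<inter> \<sigma> (C n))" using n CL C_disj by (intro disjoint) auto
      qed
    qed
    from this mono[OF CY[OF n] assms(4)] show ?thesis
      by (rule small_cover) (auto simp: V_def)
  qed
  \<comment> \<open>Otherwise \<open>\<sigma> (C n)\<close> would lie in
    \<open>\<sigma> (R a)\<close> up to a small set, making \<open>C n - R a\<close> small, although
    it contains the part of the column above \<open>a\<close>, which has size \<theta>.\<close>
  have escape: "\<exists>x. x \<in> V n - \<sigma> (R a)" if n: "n \<in> Field \<kappa>" and a: "a \<in> Field \<theta>" for n a
  proof (rule ccontr)
    assume "\<nexists>x. x \<in> V n - \<sigma> (R a)"
    then have "\<sigma> (C n) - \<sigma> (R a) \<subseteq> \<sigma> (C n) - V n" by blast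
    then have "small (\<sigma> (C n) - \<sigma> (R a))" using V_eq[OF n] subset_card_less by blast
    from this diff[OF CL[OF n] RL] have "small (\<sigma> (C n - R a))" by (rule small_cover) blast
    then have "small (C n - R a)" using null_iff CL[OF n] by blast
    moreover have "e ` ({n} \<times> (Field \<theta> - under \<theta> a)) \<subseteq> C n - R a"
      using inje n under unfolding C_def R_def inj_on_def by blast
    ultimately have "small (e ` ({n} \<times> (Field \<theta> - under \<theta> a)))" by (rule subset_card_less)
    moreover have "|Field \<theta> - under \<theta> a| \<le>o |e ` ({n} \<times> (Field \<theta> - under \<theta> a))|"
    proof (rule card_of_ordLeqI[where f = "\<lambda>t. e (n, t)"])
      show "inj_on (\<lambda>t. e (n, t)) (Field \<theta> - under \<theta> a)"
        using inje n by (auto simp: inj_on_def)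
    qed auto
    ultimately have "small (Field \<theta> - under \<theta> a)" using ordLeq_ordLess_trans by blast
    then have "|Field \<theta> - under \<theta> a| <o \<theta>" using assms(3) ordLess_transitive by blast
    from this card_of_under_less[OF assms(1) a]
    have "|(Field \<theta> - under \<theta> a) \<union> under \<theta> a| <o \<theta>" by (rule small_Un[OF assms(1)])
    then have "|Field \<theta>| <o \<theta>" by (rule subset_card_less) blast
    then show False using ft not_ordLess_ordIso by blast
  qed
  define p where "p a n = (SOME x. x \<in> V n - \<sigma> (R a))" for a n
  have p: "p a n \<in> V n - \<sigma> (R a)" if "n \<in> Field \<kappa>" "a \<in> Field \<theta>" for a n
    unfolding p_def using escape[OF that] by (rule someI_ex)
  have pY: "p a n \<in> \<sigma> Y" if "n \<in> Field \<kappa>" "a \<in> Field \<theta>" for a n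
    using p[OF that] by (auto simp: V_def)
  have VL: "V n \<subseteq> L" for n using range[OF assms(4)] by (auto simp: V_def)
  define H where "H = (\<lambda>a n. j (p a n)) ` Field \<theta>"
  have "|H| \<le>o |Field \<theta>|" unfolding H_def by (rule card_of_image)
  then have 1: "|H| \<le>o \<theta>" using ft by (rule ordLeq_ordIso_trans)
  have 2: "H \<subseteq> Field \<kappa> \<rightarrow> Field \<kappa>" using j(2) pY unfolding H_def by blast
  have 3: "\<exists>h\<in>H. \<forall>g\<in>G. small {n \<in> Field \<kappa>. (h n, g n) \<in> \<kappa>}"
    if "G \<subseteq> Field \<kappa> \<rightarrow> Field \<kappa>" and G: "|G| <o \<theta>" for G
  proof -
    \<comment> \<open>Through \<open>j\<close> the points of \<open>\<sigma> Y\<close> are read as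
      ordinals below \<kappa>, so \<open>B g\<close> is the region on or below the graph of
      \<open>g\<close>.\<close>
    define B where "B g = (\<Union>n\<in>Field \<kappa>. {x \<in> V n. (j x, g n) \<in> \<kappa>})" for g
    have BL: "B g \<subseteq> L" and BY: "B g \<subseteq> \<sigma> Y" for g using VL by (auto simp: B_def V_def)
    have "\<exists>U\<subseteq>Y. small (sym_diff (\<sigma> U) (B g))" for g
    proof -
      have "small (B g - \<sigma> Y)" using small_empty BY by (metis Diff_eq_empty_iff)
      then show ?thesis using surj_below[OF assms(4) BL] by metis
    qed
    then obtain U where U: "\<And>g. U g \<subseteq> Y" "\<And>g. small (sym_diff (\<sigma> (U g)) (B g))" by metis
    have U_card: "|U g| \<le>o \<kappa>" if g: "g \<in> G" for g
    proof -
      \<comment> \<open>Injectivity of \<open>j\<close> bounds \<open>B g \<inter> V n\<close> by an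
        initial segment of \<kappa>; pulled back through \<open>null_iff\<close>, this makes the
        trace of \<open>U g\<close> on each column small.\<close>
      have "|U g \<inter> C n| \<le>o |Field \<kappa>|" if n: "n \<in> Field \<kappa>" for n
      proof -
        have gF: "g n \<in> Field \<kappa>" using \<open>G \<subseteq> _\<close> g n by blast
        have "B g \<inter> V n \<subseteq> {x \<in> V n. (j x, g n) \<in> \<kappa>}"
          using V_disj n unfolding B_def by blast
        moreover have "|{x \<in> V n. (j x, g n) \<in> \<kappa>}| \<le>o |under \<kappa> (g n)|"
        proof (rule card_of_ordLeqI[where f = j])
          show "inj_on j {x \<in> V n. (j x, g n) \<in> \<kappa>}"
            by (rule inj_on_subset[OF j(1)]) (auto simp: V_def)
        qed (auto simp: under_def)
        then have "small {x \<in> V n. (j x, g n) \<in> \<kappa>}"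
          using card_of_under_less[OF cinf gF] by (rule ordLeq_ordLess_trans)
        ultimately have "small (B g \<inter> V n)" by (rule subset_card_less[rotated])
        from this V_eq[OF n] have "small (B g \<inter> \<sigma> (C n))" by (rule small_cover) blast
        from this U(2)[of g] have *: "small (\<sigma> (U g) \<inter> \<sigma> (C n))" by (rule small_cover) blast
        have UL: "U g \<subseteq> L" using U(1) assms(4) by blast
        from * meet[OF UL CL[OF n]] have "small (\<sigma> (U g \<inter> C n))" by (rule small_cover) blast
        then have "small (U g \<inter> C n)" using null_iff[of "U g \<inter> C n"] UL by blast
        then show ?thesis using fk by (meson ordIso_symmetric ordLess_imp_ordLeq ordLeq_ordIso_trans)
      qed
      then have "|\<Union>n\<in>Field \<kappa>. U g \<inter> C n| \<le>o |Field \<kappa>|"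
        using Cinfinite_infinite_Field[OF cinf] by (intro card_of_UNION_ordLeq_infinite) (auto intro: card_of_mono1)
      moreover have "U g = (\<Union>n\<in>Field \<kappa>. U g \<inter> C n)"
        using U(1)[of g] ime unfolding C_def by fastforce
      ultimately show ?thesis using fk by (metis ordLeq_ordIso_trans)
    qed
    \<comment> \<open>\<open>K\<close> collects the heights occurring in any \<open>U g\<close>. A
      single bound \<open>a\<close> for all of them serves every \<open>g\<close> in
      \<open>G\<close> at once.\<close>
    define K where "K = (\<Union>g\<in>G. {t \<in> Field \<theta>. \<exists>n\<in>Field \<kappa>. e (n, t) \<in> U g})"
    have "|K| <o \<theta>" unfolding K_def
    proof (rule card_of_UNION_ordLess[OF cinf assms(1,3) G])
      fix g assume "g \<in> G"
      have "{t \<in> Field \<theta>. \<exists>n\<in>Field \<kappa>. e (n, t) \<in> U g}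
          \<subseteq> (snd \<circ> inv_into (Field \<kappa> \<times> Field \<theta>) e) ` U g"
        using inje by (force simp: image_iff)
      then have "|{t \<in> Field \<theta>. \<exists>n\<in>Field \<kappa>. e (n, t) \<in> U g}| \<le>o |U g|"
        by (meson card_of_image card_of_mono1 ordLeq_transitive)
      then show "|{t \<in> Field \<theta>. \<exists>n\<in>Field \<kappa>. e (n, t) \<in> U g}| \<le>o \<kappa>"
        using U_card[OF \<open>g \<in> G\<close>] ordLeq_transitive by blast
    qed
    moreover have "K \<subseteq> Field \<theta>" by (auto simp: K_def)
    ultimately obtain a where a: "a \<in> Field \<theta>" "K \<subseteq> under \<theta> a"
      using regularCard_bounded[OF assms(1,2)] by blast
    have "small {n \<in> Field \<kappa>. (j (p a n), g n) \<in> \<kappa>}" if g: "g \<in> G" for g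
    proof -
      let ?N = "{n \<in> Field \<kappa>. (j (p a n), g n) \<in> \<kappa>}"
      have "U g \<subseteq> R a"
      proof
        fix x assume x: "x \<in> U g"
        then obtain n t where nt: "n \<in> Field \<kappa>" "t \<in> Field \<theta>" "x = e (n, t)"
          using U(1) ime by blast
        then have "t \<in> K" using x g unfolding K_def by blast
        then show "x \<in> R a" using nt a(2) unfolding R_def by blast
      qed
      then have "small (\<sigma> (U g) - \<sigma> (R a))" using RL by (rule mono)
      from this U(2)[of g] have sm: "small (B g - \<sigma> (R a))" by (rule small_cover) blast
      \<comment> \<open>Each failure of domination puts \<open>p a n\<close> into \<open>B g\<close>
        but outside \<open>\<sigma> (R a)\<close>, and different \<open>n\<close> give different
        points because the \<open>V n\<close> are disjoint.\<close>
      have "|?N| \<le>o |B g - \<sigma> (R a)|"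
      proof (rule card_of_ordLeqI[where f = "p a"])
        show "inj_on (p a) ?N"
        proof (rule inj_onI)
          fix m n assume "m \<in> ?N" "n \<in> ?N" "p a m = p a n"
          then show "m = n" using V_disj[of "p a m" m n] p[OF _ a(1), of m] p[OF _ a(1), of n] by auto
        qed
        show "p a n \<in> B g - \<sigma> (R a)" if "n \<in> ?N" for n
          using that p[OF _ a(1), of n] unfolding B_def by blast
      qed
      then show ?thesis using sm by (rule ordLeq_ordLess_trans)
    qed
    then show ?thesis using a(1) unfolding H_def by (intro bexI[of _ "\<lambda>n. j (p a n)"]) auto
  qed
  from 1 2 3 show ?thesis unfolding is_scale_def by blast
qed

section \<open>Lower bounds for the size of images\<close>

text \<open>If \<open>\<sigma> Y\<close> had size at most \<kappa>, so would the image of a subset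
  of size \<open>cardSuc \<kappa>\<close>, and both cardinals would have scales \<open>H1\<close>
  and \<open>H2\<close>. Some \<open>h\<close> in \<open>H2\<close> then dominates all of
  \<open>H1\<close>, while some \<open>g\<close> in \<open>H1\<close> dominates \<open>h\<close>.
  Since values are comparable, \<open>Field \<kappa>\<close> would be a union of two small
  sets.\<close>

lemma image_card_gt:
  assumes "Y \<subseteq> L" "|Y| =o cardSuc (cardSuc \<kappa>)"
  shows "\<kappa> <o |\<sigma> Y|"
proof (rule ccontr)
  assume "\<not> \<kappa> <o |\<sigma> Y|"
  then have Y: "|\<sigma> Y| \<le>o \<kappa>" using card_not_leq_iff[OF card] by blast
  let ?k1 = "cardSuc \<kappa>" and ?k2 = "cardSuc (cardSuc \<kappa>)"
  have i1: "Cinfinite ?k1" using cinf by (rule Cinfinite_cardSuc)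
  then have i2: "Cinfinite ?k2" by (rule Cinfinite_cardSuc)
  have l1: "\<kappa> <o ?k1" using card by (rule cardSuc_greater)
  have l2: "?k1 <o ?k2" using i1 by (intro cardSuc_greater) blast
  have l: "\<kappa> <o ?k2" using l1 l2 by (rule ordLess_transitive)
  have "?k1 \<le>o |Y|"
    using l2 assms(2) by (meson ordIso_symmetric ordLess_imp_ordLeq ordLeq_ordIso_trans)
  moreover have "Card_order ?k1" using i1 by blast
  ultimately obtain X where X: "X \<subseteq> Y" "|X| =o ?k1" using subset_of_cardinality by blast
  have "small (\<sigma> X - \<sigma> Y)" using X(1) assms(1) by (rule mono)
  then have "|(\<sigma> X - \<sigma> Y) \<union> \<sigma> Y| \<le>o \<kappa>"
    using Y cinf by (intro card_of_Un_ordLeq_infinite_Field) (auto simp: cinfinite_def intro: small_leq)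
  moreover have "|\<sigma> X| \<le>o |(\<sigma> X - \<sigma> Y) \<union> \<sigma> Y|" by (rule card_of_mono1) blast
  ultimately have sX: "|\<sigma> X| \<le>o \<kappa>" using ordLeq_transitive by blast
  have XL: "X \<subseteq> L" using X(1) assms(1) by blast
  obtain H1 where H1: "is_scale ?k1 H1"
    using ex_is_scale[OF i1 regularCard_cardSuc[OF cinf] l1 XL X(2) sX] by blast
  obtain H2 where H2: "is_scale ?k2 H2"
    using ex_is_scale[OF i2 regularCard_cardSuc[OF i1] l assms Y] by blast
  have F: "H1 \<subseteq> Field \<kappa> \<rightarrow> Field \<kappa>" "H2 \<subseteq> Field \<kappa> \<rightarrow> Field \<kappa>" "|H1| \<le>o ?k1"
    using H1 H2 unfolding is_scale_def by blast+
  from F(3) l2 have "|H1| <o ?k2" by (rule ordLeq_ordLess_trans)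
  then obtain h where h: "h \<in> H2" "\<forall>g\<in>H1. small {n \<in> Field \<kappa>. (h n, g n) \<in> \<kappa>}"
    using H2 F(1) unfolding is_scale_def by meson
  have "|{h}| <o ?k1"
    by (rule Cfinite_ordLess_Cinfinite) (use i1 in \<open>simp_all add: cfinite_def Field_card_of card_of_card_order_on\<close>)
  moreover have "{h} \<subseteq> Field \<kappa> \<rightarrow> Field \<kappa>" using h(1) F(2) by blast
  ultimately obtain g where g: "g \<in> H1" "small {n \<in> Field \<kappa>. (g n, h n) \<in> \<kappa>}"
    using H1 unfolding is_scale_def by (meson singletonI)
  have gh: "g \<in> Field \<kappa> \<rightarrow> Field \<kappa>" "h \<in> Field \<kappa> \<rightarrow> Field \<kappa>" using g(1) h(1) F by blast+
  have "wo_rel \<kappa>" using card by (simp add: wo_rel_def card_order_on_well_order_on)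
  then have "Field \<kappa> \<subseteq> {n \<in> Field \<kappa>. (g n, h n) \<in> \<kappa>} \<union> {n \<in> Field \<kappa>. (h n, g n) \<in> \<kappa>}"
    using wo_rel.TOTALS gh by fastforce
  with g(2) bspec[OF h(2) g(1)] have "small (Field \<kappa>)" by (rule small_cover)
  then show False using card_of_Field_ordIso[OF card] not_ordLess_ordIso by blast
qed

text \<open>
  For a counterexample \<open>W\<close> with \<open>|\<sigma> W|\<close> minimal, the proper initial segments of \<open>\<sigma> W\<close> come from
  sets that together do not exhaust \<open>W\<close>. The image of what is left is almost disjoint from all
  initial segments, hence has size at most \<open>\<kappa>\<close>.
\<close>

lemma image_card_geq:
  assumes "W \<subseteq> L" "cardSuc (cardSuc \<kappa>) \<le>o |W|"
  shows "|W| \<le>o |\<sigma> W|"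
  using assms
proof (induction W rule: wf_induct_rule[OF wf_inv_image[OF wf_ordLess, of "\<lambda>W. |\<sigma> W|"]])
  case (1 W)
  note W = "1.prems"
  have IH: "|U| \<le>o |\<sigma> U|" if "U \<subseteq> L" "|\<sigma> U| <o |\<sigma> W|" "cardSuc (cardSuc \<kappa>) \<le>o |U|" for U
    using "1.IH"[of U] that by (simp add: inv_image_def)
  let ?k1 = "cardSuc \<kappa>" and ?k2 = "cardSuc (cardSuc \<kappa>)"
  have i1: "Cinfinite ?k1" using cinf by (rule Cinfinite_cardSuc)
  then have i2: "Cinfinite ?k2" by (rule Cinfinite_cardSuc)
  have c2: "Card_order ?k2" using i2 by blast
  have l1: "\<kappa> <o ?k1" using card by (rule cardSuc_greater)
  have l2: "?k1 <o ?k2" using i1 by (intro cardSuc_greater) blast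
  have l: "\<kappa> <o ?k2" using l1 l2 by (rule ordLess_transitive)
  have f1: "|Field ?k1| =o ?k1" using i1 card_of_Field_ordIso by blast
  show ?case
  proof (rule ccontr)
    assume "\<not> |W| \<le>o |\<sigma> W|"
    then have less: "|\<sigma> W| <o |W|" by (simp add: card_not_leq_iff card_of_Card_order)
    let ?r = "|\<sigma> W|" and ?A = "\<sigma> W"
    \<comment> \<open>The size of \<open>?b\<close> is the larger of \<open>|\<sigma> W|\<close> and
      \<open>cardSuc \<kappa>\<close>; both are below \<open>|W|\<close>.\<close>
    let ?b = "?A <+> Field ?k1"
    have infb: "infinite ?b" using i1 by (simp add: cinfinite_def)
    have k1b: "?k1 \<le>o |?b|" using f1 card_of_Plus2 by (meson ordIso_symmetric ordIso_ordLeq_trans)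
    have AL: "?A \<subseteq> L" using W(1) by (rule range)
    have "\<exists>U\<subseteq>W. small (sym_diff (\<sigma> U) (underS ?r a)) \<and> |U| \<le>o |?b|" if a: "a \<in> ?A" for a
    proof -
      have sub: "underS ?r a \<subseteq> ?A" using Field_card_of[of ?A] by (auto simp: underS_def Field_def)
      then have "small (underS ?r a - \<sigma> W)" using small_empty by (metis Diff_eq_empty_iff)
      moreover have "underS ?r a \<subseteq> L" using sub AL by blast
      ultimately obtain U where U: "U \<subseteq> W" "small (sym_diff (\<sigma> U) (underS ?r a))"
        using surj_below[OF W(1)] by blast
      have UL: "U \<subseteq> L" using U(1) W(1) by blast
      have us: "|underS ?r a| <o ?r" using a by (intro card_of_underS card_of_Card_order) (simp add: Field_card_of)
      \<comment> \<open>Preimages of size at most \<open>cardSuc \<kappa>\<close> fit into the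
        second summand. For larger ones the induction hypothesis applies, since their images are
        smaller than \<open>\<sigma> W\<close>.\<close>
      have "|U| \<le>o |?b|"
      proof (cases "?k2 \<le>o |U|")
        case False
        then have "|U| <o ?k2" using card_not_less_iff[OF c2] by blast
        then have "|U| \<le>o ?k1" using i1 by (simp add: cardSuc_ordLeq_ordLess card_of_Card_order)
        then show ?thesis using k1b ordLeq_transitive by blast
      next
        case True
        \<comment> \<open>A large \<open>U\<close> forces \<kappa> to be strictly below
          \<open>|\<sigma> W|\<close>, so altering the initial segment by a small set keeps it
          shorter than \<open>\<sigma> W\<close>.\<close>
        have "\<not> small U" using True l
          by (meson not_ordLess_ordLeq ordLess_ordLeq_trans ordLess_transitive)
        then have "\<not> small (\<sigma> U)" using null_iff[OF UL] by blast
        then have "\<not> small (underS ?r a)" using U(2) small_cover[of "sym_diff (\<sigma> U) (underS ?r a)"] by blast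
        then have "\<kappa> \<le>o |underS ?r a|" using card_not_less_iff[OF card] by blast
        then have kr: "\<kappa> <o ?r" using us by (rule ordLeq_ordLess_trans)
        then have "Cinfinite ?r" using cinf by (meson card_of_Card_order cinfinite_mono ordLess_imp_ordLeq)
        then have sU: "|\<sigma> U| <o ?r" using small_sym_diff_card_less[OF _ kr us U(2)] by blast
        then have "|U| \<le>o |\<sigma> U|" using IH[OF UL _ True] by blast
        then have "|U| \<le>o ?r" using sU ordLess_imp_ordLeq ordLeq_transitive by blast
        then show ?thesis using card_of_Plus1 ordLeq_transitive by blast
      qed
      with U show ?thesis by blast
    qed
    then obtain U where U: "\<And>a. a \<in> ?A \<Longrightarrow> U a \<subseteq> W"
      "\<And>a. a \<in> ?A \<Longrightarrow> small (sym_diff (\<sigma> (U a)) (underS ?r a))"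
      "\<And>a. a \<in> ?A \<Longrightarrow> |U a| \<le>o |?b|" by metis
    have "|\<Union>a\<in>?A. U a| \<le>o |?b|"
      using infb U(3) by (intro card_of_UNION_ordLeq_infinite) (auto simp: card_of_Plus1)
    moreover have ciW: "Cinfinite |W|" using i2 W(2) by (meson card_of_Card_order cinfinite_mono)
    have "|?b| <o |W|"
    proof (rule card_of_Plus_ordLess_infinite_Field)
      show "infinite (Field |W| )" using ciW by (simp add: cinfinite_def)
      show "|Field ?k1| <o |W|" using f1 l2 W(2)
        by (meson ordIso_ordLess_trans ordLess_ordLeq_trans)
    qed (use less in \<open>auto simp: card_of_Card_order\<close>)
    ultimately have un: "|\<Union>a\<in>?A. U a| <o |W|" by (rule ordLeq_ordLess_trans)
    have "\<not> ( |W - (\<Union>a\<in>?A. U a)| <o |W| )"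
    proof
      assume "|W - (\<Union>a\<in>?A. U a)| <o |W|"
      from this un have "|(W - (\<Union>a\<in>?A. U a)) \<union> (\<Union>a\<in>?A. U a)| <o |W|" by (rule small_Un[OF ciW])
      then have "|W| <o |W|" by (rule subset_card_less) blast
      then show False using ordLess_irreflexive by blast
    qed
    then have "?k2 \<le>o |W - (\<Union>a\<in>?A. U a)|" using W(2) by (meson ordLeq_transitive not_ordLess_iff_ordLeq card_of_Well_order)
    then obtain Y where Y: "Y \<subseteq> W - (\<Union>a\<in>?A. U a)" "|Y| =o ?k2"
      using subset_of_cardinality[OF c2] by blast
    have YL: "Y \<subseteq> L" using Y(1) W(1) by blast
    let ?Z = "\<sigma> Y \<inter> ?A"
    have "|?Z| \<le>o \<kappa>"
    proof (rule card_of_leq_if_initial_segments_less[OF card, of ?r])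
      fix a assume "a \<in> ?Z"
      then have a: "a \<in> ?A" by blast
      have "small (\<sigma> Y \<inter> \<sigma> (U a))" using YL U(1)[OF a] W(1) Y(1) a by (intro disjoint) blast+
      from this U(2)[OF a] show "small (?Z \<inter> underS ?r a)" by (rule small_cover) blast
    next
      show "Well_order ?r" by (rule card_of_Well_order)
      show "?Z \<subseteq> Field ?r" by (simp add: Field_card_of)
    qed
    moreover have "small (\<sigma> Y - ?A)" using Y(1) W(1) by (intro mono) auto
    ultimately have "|(\<sigma> Y - ?A) \<union> ?Z| \<le>o \<kappa>"
      using cinf by (intro card_of_Un_ordLeq_infinite_Field) (auto simp: cinfinite_def intro: small_leq)
    then have "|\<sigma> Y| \<le>o \<kappa>" by (metis Un_Diff_Int)
    then show False using image_card_gt[OF YL Y(2)] not_ordLess_ordLeq by blast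
  qed
qed

section \<open>Where \<open>f\<close> fails to induce the automorphism\<close>

text \<open>If \<open>f\<close> fails at \<open>A\<close>, then a non-small part of
  \<open>\<sigma> A\<close> is mapped outside \<open>A\<close>, or a non-small part of
  \<open>\<sigma> (T - A)\<close> is mapped into \<open>A\<close>. With \<open>B\<close> equal to
  \<open>A\<close> or \<open>T - A\<close>, this is a set \<open>Q\<close> in
  \<open>\<sigma> B\<close> whose points \<open>f\<close> maps outside \<open>B\<close>. It can
  avoid \<open>N\<close>, since \<open>T\<close> misses the preimage \<open>W\<close> of
  \<open>N\<close>. Pulling \<open>Q\<close> back below \<open>B\<close> and cutting to size
  \<kappa> yields \<open>X\<close>, and then \<open>Y\<close> inside
  \<open>\<sigma> X \<inter> Q\<close>.\<close>

lemma ex_displaced_set: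
  assumes N: "N \<subseteq> L" and W: "W \<subseteq> L" "small (sym_diff (\<sigma> W) N)"
    and T: "T \<subseteq> L" "T \<inter> W = {}"
    and nontrivial: "\<not> (\<forall>A\<subseteq>T. small (sym_diff (\<sigma> A) (f -` A \<inter> (f -` T \<inter> \<sigma> T - N))))"
  obtains X Y where "X \<subseteq> T" "Y \<subseteq> L - N" "|X| =o \<kappa>" "|Y| =o \<kappa>" "small (Y - \<sigma> X)" "f ` Y \<inter> X = {}"
proof -
  obtain B Q where B: "B \<subseteq> T" and Q: "Q \<subseteq> \<sigma> B - f -` B - N" "\<not> small Q"
  proof -
    let ?D = "f -` T \<inter> \<sigma> T - N"
    obtain A where A: "A \<subseteq> T" "\<not> small (sym_diff (\<sigma> A) (f -` A \<inter> ?D))"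
      using nontrivial by blast
    have AL: "A \<subseteq> L" using A(1) T(1) by blast
    consider "\<not> small (\<sigma> A - f -` A \<inter> ?D)" | "\<not> small (f -` A \<inter> ?D - \<sigma> A)"
      using A(2) small_Un[OF cinf] by blast
    then show thesis
    proof cases
      case 1
      have "small (\<sigma> A \<inter> \<sigma> W)" using A(1) T AL W(1) by (intro disjoint) auto
      from this W(2) have "small (\<sigma> A \<inter> N)" by (rule small_cover) blast
      from this mono[OF A(1) T(1)] have *: "small (\<sigma> A \<inter> N \<union> (\<sigma> A - \<sigma> T))"
        by (rule small_Un[OF cinf])
      have "\<not> small (\<sigma> A - f -` A - N)"
      proof
        assume "small (\<sigma> A - f -` A - N)"
        with * have "small (\<sigma> A - f -` A \<inter> ?D)" by (rule small_cover) (use A(1) in blast)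
        with 1 show False by blast
      qed
      with A(1) that show thesis by blast
    next
      case 2
      have "\<not> small (\<sigma> (T - A) \<inter> f -` A - N)"
      proof
        assume "small (\<sigma> (T - A) \<inter> f -` A - N)"
        from this diff[OF T(1) AL] have "small (f -` A \<inter> ?D - \<sigma> A)"
          by (rule small_cover) blast
        with 2 show False by blast
      qed
      then show thesis by (rule that[of "T - A", rotated 2]) auto
    qed
  qed
  have BL: "B \<subseteq> L" using B T(1) by blast
  have "small (Q - \<sigma> B)" using Q(1) small_empty by (metis Diff_eq_empty_iff Diff_subset order_trans)
  moreover have "Q \<subseteq> L" using Q(1) range[OF BL] by blast
  ultimately obtain X' where X': "X' \<subseteq> B" "small (sym_diff (\<sigma> X') Q)"
    using surj_below[OF BL] by blast
  have X'L: "X' \<subseteq> L" using X'(1) BL by blast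
  have "\<not> small (\<sigma> X')" using small_cover[OF _ X'(2), of "\<sigma> X'" Q] Q(2) by blast
  then have "\<kappa> \<le>o |X'|" using null_iff[OF X'L] card_not_less_iff[OF card] by blast
  then obtain X where X: "X \<subseteq> X'" "|X| =o \<kappa>" using subset_of_cardinality[OF card] by blast
  have XL: "X \<subseteq> L" using X(1) X'L by blast
  have nX: "\<not> small X" using X(2) not_ordLess_ordIso by blast
  have "\<not> small (\<sigma> X \<inter> Q)"
  proof
    assume 1: "small (\<sigma> X \<inter> Q)"
    have "small ((\<sigma> X - \<sigma> X') \<union> sym_diff (\<sigma> X') Q)"
      using mono[OF X(1) X'L] X'(2) by (rule small_Un[OF cinf])
    from this 1 have "small (\<sigma> X)" by (rule small_cover) blast
    with nX null_iff[OF XL] show False by blast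
  qed
  then have "\<kappa> \<le>o |\<sigma> X \<inter> Q|" using card_not_less_iff[OF card] by blast
  then obtain Y where Y: "Y \<subseteq> \<sigma> X \<inter> Q" "|Y| =o \<kappa>" using subset_of_cardinality[OF card] by blast
  have "Y - \<sigma> X = {}" using Y(1) by blast
  then have "small (Y - \<sigma> X)" using small_empty by metis
  moreover have "X \<subseteq> T" using X(1) X'(1) B by blast
  moreover have "Y \<subseteq> L - N" using Y(1) Q(1) \<open>Q \<subseteq> L\<close> by blast
  moreover have "f ` Y \<inter> X = {}" using Y(1) Q(1) X(1) X'(1) by blast
  ultimately show thesis using that X(2) Y(2) by blast
qed

text \<open>
  The pairs \<open>(X, Y)\<close> witness that \<open>f\<close> fails to induce \<open>\<sigma>\<close> on \<open>X\<close>. Since \<open>\<Union>X\<close> still misses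
  every \<open>f ` Y\<close>, a family of \<open>\<mu>\<close> such pairs would make \<open>\<sigma> (\<Union>X)\<close> and \<open>f -` (\<Union>X)\<close> differ by
  \<open>\<mu>\<close> points; a maximal family is therefore smaller, and outside of it \<open>f\<close> induces \<open>\<sigma>\<close>.
\<close>

lemma trivial_off_small_set:
  fixes \<mu> :: "'m rel"
  assumes \<mu>: "Cinfinite \<mu>" "\<kappa> <o \<mu>"
    and induces: "\<And>A. A \<subseteq> L \<Longrightarrow> |sym_diff (\<sigma> A) (f -` A \<inter> L)| <o \<mu>"
    and image_less: "\<And>A. A \<subseteq> L \<Longrightarrow> |A| <o \<mu> \<Longrightarrow> |\<sigma> A| <o \<mu>"
    and preimage_less: "\<And>A. A \<subseteq> L \<Longrightarrow> |\<sigma> A| <o \<mu> \<Longrightarrow> |A| <o \<mu>"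
  obtains T D where "T \<subseteq> L" "|L - T| <o \<mu>" "D \<subseteq> L" "f \<in> D \<rightarrow> T"
    "\<And>A. A \<subseteq> T \<Longrightarrow> small (sym_diff (\<sigma> A) (f -` A \<inter> D))"
proof -
  define good where "good P \<longleftrightarrow> (case P of (X, Y) \<Rightarrow>
    X \<subseteq> L \<and> Y \<subseteq> L \<and> |X| =o \<kappa> \<and> |Y| =o \<kappa> \<and> small (Y - \<sigma> X))" for P
  \<comment> \<open>The case \<open>P = Q\<close> says that \<open>f\<close> displaces the second
    set of a pair off the first. First components of different pairs may overlap.\<close>
  define free where "free P Q \<longleftrightarrow> f ` snd P \<inter> fst Q = {} \<and> (P \<noteq> Q \<longrightarrow> snd P \<inter> snd Q = {})"
    for P Q :: "'a set \<times> 'a set"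
  define fams where "fams = {F. (\<forall>P\<in>F. good P) \<and> (\<forall>P\<in>F. \<forall>Q\<in>F. free P Q)}"
  have "\<exists>M\<in>fams. \<forall>F\<in>fams. M \<subseteq> F \<longrightarrow> F = M"
  proof (rule subset_Zorn')
    fix C assume C: "subset.chain fams C"
    have "free P Q" if "P \<in> F" "F \<in> C" "Q \<in> G" "G \<in> C" for P Q F G
    proof -
      have "F \<subseteq> G \<or> G \<subseteq> F" using C that by (auto simp: subset.chain_def)
      moreover have "F \<in> fams" "G \<in> fams" using C that by (auto simp: subset.chain_def)
      ultimately show ?thesis using that by (auto simp: fams_def)
    qed
    moreover have "good P" if "P \<in> F" "F \<in> C" for P F
      using C that by (auto simp: subset.chain_def fams_def)
    ultimately show "\<Union>C \<in> fams" by (simp add: fams_def)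
  qed
  then obtain M where M: "M \<in> fams" and max: "\<And>F. F \<in> fams \<Longrightarrow> M \<subseteq> F \<Longrightarrow> F = M" by blast
  have good: "good P" if "P \<in> M" for P using M that by (simp add: fams_def)
  have free: "free P Q" if "P \<in> M" "Q \<in> M" for P Q using M that by (simp add: fams_def)
  define SX where "SX = (\<Union>P\<in>M. fst P)"
  define SY where "SY = (\<Union>P\<in>M. snd P)"
  have SL: "SX \<subseteq> L" "SY \<subseteq> L" using good by (auto simp: SX_def SY_def good_def split_beta)
  have M_less: "|M| <o \<mu>"
  proof -
    \<comment> \<open>One point is chosen per pair. It lies in \<open>\<sigma> SX\<close>, but
      \<open>f\<close> sends it outside \<open>SX\<close>, so \<open>M\<close> injects into a
      symmetric difference of size less than \<mu>.\<close>
    have "\<exists>y. y \<in> snd P \<inter> \<sigma> SX" if P: "P \<in> M" for P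
    proof (rule ccontr)
      assume "\<nexists>y. y \<in> snd P \<inter> \<sigma> SX"
      then have sub: "snd P \<subseteq> (snd P - \<sigma> (fst P)) \<union> (\<sigma> (fst P) - \<sigma> SX)" by blast
      have "small (snd P - \<sigma> (fst P))" using good[OF P] by (simp add: good_def split_beta)
      moreover have "small (\<sigma> (fst P) - \<sigma> SX)" using P SL by (intro mono) (auto simp: SX_def)
      ultimately have "small (snd P)" using sub by (rule small_cover)
      moreover have "|snd P| =o \<kappa>" using good[OF P] by (simp add: good_def split_beta)
      ultimately show False using not_ordLess_ordIso by blast
    qed
    then obtain y where y: "\<And>P. P \<in> M \<Longrightarrow> y P \<in> snd P \<inter> \<sigma> SX" by metis
    have "|M| \<le>o |sym_diff (\<sigma> SX) (f -` SX \<inter> L)|"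
    proof (rule card_of_ordLeqI[where f = y])
      show "inj_on y M"
      proof (rule inj_onI, rule ccontr)
        fix P Q assume "P \<in> M" "Q \<in> M" "y P = y Q" "P \<noteq> Q"
        then show False using y[of P] y[of Q] free[of P Q] by (auto simp: free_def)
      qed
      show "y P \<in> sym_diff (\<sigma> SX) (f -` SX \<inter> L)" if P: "P \<in> M" for P
        using y[OF P] free[OF P] unfolding free_def SX_def by blast
    qed
    then show ?thesis using induces[OF SL(1)] by (rule ordLeq_ordLess_trans)
  qed
  have SX_less: "|SX| <o \<mu>" unfolding SX_def
    by (rule card_of_UNION_ordLess[OF cinf \<mu> M_less])
      (use good in \<open>auto simp: good_def split_beta intro: ordIso_imp_ordLeq\<close>)
  have SY_less: "|SY| <o \<mu>" unfolding SY_def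
    by (rule card_of_UNION_ordLess[OF cinf \<mu> M_less])
      (use good in \<open>auto simp: good_def split_beta intro: ordIso_imp_ordLeq\<close>)
  have "|sym_diff (\<sigma> SX) (f -` SX \<inter> L) \<union> \<sigma> SX| <o \<mu>"
    using induces[OF SL(1)] image_less[OF SL(1) SX_less] by (rule small_Un[OF \<mu>(1)])
  then have "|f -` SX \<inter> L| <o \<mu>" by (rule subset_card_less) blast
  define N where "N = SY \<union> f -` SX \<inter> L"
  have N_less: "|N| <o \<mu>" unfolding N_def using SY_less \<open>|f -` SX \<inter> L| <o \<mu>\<close> by (rule small_Un[OF \<mu>(1)])
  have NL: "N \<subseteq> L" using SL by (auto simp: N_def)
  obtain W where W: "W \<subseteq> L" "small (sym_diff (\<sigma> W) N)" using surj[OF NL] by blast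
  have W_less: "|W| <o \<mu>"
    using preimage_less[OF W(1)] small_sym_diff_card_less[OF \<mu> N_less W(2)] by blast
  define T where "T = L - (W \<union> f ` SY)"
  define D where "D = f -` T \<inter> \<sigma> T - N"
  have TL: "T \<subseteq> L" by (auto simp: T_def)
  have "|f ` SY| <o \<mu>" using card_of_image SY_less by (rule ordLeq_ordLess_trans)
  with W_less have "|W \<union> f ` SY| <o \<mu>" by (rule small_Un[OF \<mu>(1)])
  then have T_less: "|L - T| <o \<mu>" by (rule subset_card_less) (auto simp: T_def)
  have "\<forall>A\<subseteq>T. small (sym_diff (\<sigma> A) (f -` A \<inter> D))"
  proof (rule ccontr)
    assume "\<not> ?thesis"
    moreover have "T \<inter> W = {}" by (auto simp: T_def)
    ultimately obtain X Y where XY: "X \<subseteq> T" "Y \<subseteq> L - N" "|X| =o \<kappa>" "|Y| =o \<kappa>"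
      "small (Y - \<sigma> X)" "f ` Y \<inter> X = {}"
      unfolding D_def using ex_displaced_set[OF NL W TL] by blast
    have "good (X, Y)" using XY TL by (auto simp: good_def)
    moreover have "free (X, Y) (X, Y)" using XY(6) by (simp add: free_def)
    moreover have "free (X, Y) P \<and> free P (X, Y)" if "P \<in> M" for P
    proof -
      have "f ` Y \<inter> SX = {}" "Y \<inter> SY = {}" using XY(2) by (auto simp: N_def)
      moreover have "f ` SY \<inter> X = {}" using XY(1) by (auto simp: T_def)
      moreover have "fst P \<subseteq> SX" "snd P \<subseteq> SY" using that by (auto simp: SX_def SY_def)
      ultimately show ?thesis unfolding free_def fst_conv snd_conv by blast
    qed
    ultimately have "insert (X, Y) M \<in> fams" using M by (auto simp: fams_def)
    \<comment> \<open>By maximality the new pair is already in \<open>M\<close>, so \<open>Y\<close>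
      lies in \<open>SY\<close> and thus in \<open>N\<close>, which it was chosen to avoid.\<close>
    then have "(X, Y) \<in> M" using max by blast
    then have "Y \<subseteq> N" by (force simp: N_def SY_def)
    then have "Y = {}" using XY(2) by blast
    then show False using XY(4) small_empty not_ordLess_ordIso by blast
  qed
  moreover have "D \<subseteq> L" "f \<in> D \<rightarrow> T" using range[OF TL] by (auto simp: D_def)
  ultimately show thesis using that TL T_less by blast
qed

end

section \<open>From automorphisms of the quotient to selectors\<close>

lemma cls_eq_iff:
  assumes "Cinfinite \<kappa>" "A \<subseteq> L" "B \<subseteq> L"
  shows "cls L (small_ideal L \<kappa>) A = cls L (small_ideal L \<kappa>) B \<longleftrightarrow> |sym_diff A B| <o \<kappa>"
proof -
  have "cls L (small_ideal L \<kappa>) A = cls L (small_ideal L \<kappa>) B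
      \<longleftrightarrow> (A, B) \<in> ideal_rel L (small_ideal L \<kappa>)"
    unfolding cls_def using eq_equiv_class_iff[OF equiv_ideal_rel[OF assms(1)]] assms(2,3) by auto
  also have "\<dots> \<longleftrightarrow> |sym_diff A B| <o \<kappa>"
    using assms(2,3) by (auto simp: ideal_rel_def small_ideal_def)
  finally show ?thesis .
qed

lemma quot_iff: "X \<in> quot L I \<longleftrightarrow> (\<exists>A\<subseteq>L. X = cls L I A)"
  by (auto simp: quot_def cls_def quotient_def)

text \<open>Differences reduce to meets with complements; \<open>null_iff\<close> follows from
  injectivity and preservation of zero.\<close>

lemma boolean_lift_selector:
  assumes \<kappa>: "Cinfinite \<kappa>" "regularCard \<kappa>"
    and aut: "automorphism L (small_ideal L \<kappa>) \<pi>" and sel: "selector L (small_ideal L \<kappa>) \<pi> \<sigma>"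
  shows "boolean_lift L \<kappa> \<sigma>"
proof
  let ?c = "cls L (small_ideal L \<kappa>)"
  note eq = cls_eq_iff[OF \<kappa>(1)]
  have range: "\<sigma> A \<subseteq> L" and sel: "\<pi> (?c A) = ?c (\<sigma> A)" if "A \<subseteq> L" for A
    using sel that by (auto simp: selector_def)
  have inQ: "?c A \<in> quot L (small_ideal L \<kappa>)" if "A \<subseteq> L" for A using that by (auto simp: quot_iff)
  have bij: "bij_betw \<pi> (quot L (small_ideal L \<kappa>)) (quot L (small_ideal L \<kappa>))"
    using aut by (simp add: automorphism_def)
  have meet: "?c (\<sigma> (A \<inter> B)) = ?c (\<sigma> A \<inter> \<sigma> B)" if "A \<subseteq> L" "B \<subseteq> L" for A B
  proof -
    have "A \<inter> B \<subseteq> L" using that by blast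
    then have "?c (\<sigma> (A \<inter> B)) = \<pi> (quot_meet L (small_ideal L \<kappa>) (?c A) (?c B))"
      using that by (simp add: quot_binop_cls[OF \<kappa>(1)] sel)
    also have "\<dots> = quot_meet L (small_ideal L \<kappa>) (\<pi> (?c A)) (\<pi> (?c B))"
      using aut inQ that by (simp add: automorphism_def)
    finally show ?thesis using that range by (simp add: quot_binop_cls[OF \<kappa>(1)] sel)
  qed
  have compl: "?c (\<sigma> (L - B)) = ?c (L - \<sigma> B)" if "B \<subseteq> L" for B
  proof -
    have "?c (\<sigma> (L - B)) = \<pi> (quot_compl L (small_ideal L \<kappa>) (?c B))"
      using that by (simp add: quot_compl_cls[OF \<kappa>(1)] sel)
    also have "\<dots> = quot_compl L (small_ideal L \<kappa>) (\<pi> (?c B))"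
      using aut inQ that by (simp add: automorphism_def)
    finally show ?thesis using that range by (simp add: quot_compl_cls[OF \<kappa>(1)] sel)
  qed
  show "Cinfinite \<kappa>" "regularCard \<kappa>" by fact+
  show "\<sigma> A \<subseteq> L" if "A \<subseteq> L" for A using range[OF that] .
  show m: "|sym_diff (\<sigma> (A \<inter> B)) (\<sigma> A \<inter> \<sigma> B)| <o \<kappa>" if "A \<subseteq> L" "B \<subseteq> L" for A B
  proof -
    have "\<sigma> (A \<inter> B) \<subseteq> L" "\<sigma> A \<inter> \<sigma> B \<subseteq> L" using range[of "A \<inter> B"] range[of A] that by auto
    then show ?thesis using meet[OF that] eq by blast
  qed
  show "|sym_diff (\<sigma> (A - B)) (\<sigma> A - \<sigma> B)| <o \<kappa>" if "A \<subseteq> L" "B \<subseteq> L" for A B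
  proof -
    have 1: "A \<inter> (L - B) = A - B" using that by blast
    have "|sym_diff (\<sigma> (A - B)) (\<sigma> A \<inter> \<sigma> (L - B))| <o \<kappa>"
      using m[of A "L - B"] that 1 by auto
    moreover have "|sym_diff (\<sigma> (L - B)) (L - \<sigma> B)| <o \<kappa>"
      using compl[OF that(2)] eq[of "\<sigma> (L - B)" L "L - \<sigma> B"] range[of "L - B"] by blast
    ultimately have "|sym_diff (\<sigma> (A - B)) (\<sigma> A \<inter> \<sigma> (L - B)) \<union> sym_diff (\<sigma> (L - B)) (L - \<sigma> B)| <o \<kappa>"
      by (rule small_Un[OF \<kappa>(1)])
    then show ?thesis by (rule subset_card_less) (use range[OF that(1)] in blast)
  qed
  show "( |\<sigma> A| <o \<kappa>) = ( |A| <o \<kappa>)" if "A \<subseteq> L" for A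
  proof -
    have "|A| <o \<kappa> \<longleftrightarrow> ?c A = ?c {}" using eq[OF that, of "{}"] by simp
    also have "\<dots> \<longleftrightarrow> \<pi> (?c A) = \<pi> (?c {})"
      using bij inQ[OF that] inQ[of "{}"] by (auto simp: bij_betw_def inj_on_def)
    also have "\<dots> \<longleftrightarrow> ?c (\<sigma> A) = ?c {}" using aut sel[OF that] by (simp add: automorphism_def)
    also have "\<dots> \<longleftrightarrow> |\<sigma> A| <o \<kappa>" using eq[OF range[OF that], of "{}"] by simp
    finally show ?thesis by blast
  qed
  show "\<exists>A\<subseteq>L. |sym_diff (\<sigma> A) B| <o \<kappa>" if "B \<subseteq> L" for B
  proof -
    obtain Q where "Q \<in> quot L (small_ideal L \<kappa>)" "\<pi> Q = ?c B"
      using bij inQ[OF \<open>B \<subseteq> L\<close>] unfolding bij_betw_def by (metis imageE)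
    then obtain A where A: "A \<subseteq> L" "\<pi> (?c A) = ?c B" by (auto simp: quot_iff)
    then have "|sym_diff (\<sigma> A) B| <o \<kappa>" using sel[OF A(1)] eq[OF range[OF A(1)] that] by simp
    with A(1) show ?thesis by blast
  qed
qed

text \<open>The union defining \<open>induced_map\<close> contains the class of
  \<open>\<sigma> B\<close> for every representative \<open>B\<close>. Its being a single class
  therefore constrains all representatives at once.\<close>

lemma induced_map_cls_eqD:
  assumes "Cinfinite \<mu>" "A \<subseteq> L" "\<And>X. X \<subseteq> L \<Longrightarrow> \<sigma> X \<subseteq> L" "C \<subseteq> L"
    and ind: "induced_map L (small_ideal L \<mu>) \<sigma> (cls L (small_ideal L \<mu>) A) = cls L (small_ideal L \<mu>) C"
    and B: "B \<subseteq> L" "|sym_diff A B| <o \<mu>"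
  shows "|sym_diff (\<sigma> B) C| <o \<mu>"
proof -
  have "B \<in> cls L (small_ideal L \<mu>) A"
    using assms(2) B by (auto simp: cls_def ideal_rel_def small_ideal_def)
  moreover have "\<sigma> B \<in> cls L (small_ideal L \<mu>) (\<sigma> B)"
    using equiv_class_self[OF equiv_ideal_rel[OF assms(1)]] assms(3)[OF B(1)] by (simp add: cls_def)
  ultimately have "\<sigma> B \<in> cls L (small_ideal L \<mu>) C" using ind by (auto simp: induced_map_def)
  then show ?thesis by (auto simp: cls_def ideal_rel_def small_ideal_def Un_commute)
qed

theorem theorem3p3:
  fixes \<kappa> :: "'k rel" and \<mu> :: "'m rel" and \<Lambda> :: "'a rel"
    and \<pi> :: "'a set set \<Rightarrow> 'a set set" and \<sigma> :: "'a set \<Rightarrow> 'a set"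
  assumes "Cinfinite \<kappa>" and "Cinfinite \<mu>" and "Cinfinite \<Lambda>"
    and "\<kappa> <o \<mu>" and "\<mu> \<le>o \<Lambda>"
    and "regularCard \<kappa>" and "regularCard \<mu>"
    and "automorphism (Field \<Lambda>) (small_ideal (Field \<Lambda>) \<kappa>) \<pi>"
    and "cardinality_preserving (Field \<Lambda>) (small_ideal (Field \<Lambda>) \<kappa>) \<pi> \<or> cardSuc \<kappa> <o \<mu>"
    and "selector (Field \<Lambda>) (small_ideal (Field \<Lambda>) \<kappa>) \<pi> \<sigma>"
    and "trivial_aut (Field \<Lambda>) (small_ideal (Field \<Lambda>) \<mu>)
           (induced_map (Field \<Lambda>) (small_ideal (Field \<Lambda>) \<mu>) \<sigma>)"
  shows "almost_trivial (Field \<Lambda>) (small_ideal (Field \<Lambda>) \<kappa>) \<mu> \<pi>"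
proof -
  let ?L = "Field \<Lambda>"
  interpret boolean_lift ?L \<kappa> \<sigma> using assms(1,6,8,10) by (rule boolean_lift_selector)
  obtain f where ind: "\<And>A. A \<subseteq> ?L \<Longrightarrow> induced_map ?L (small_ideal ?L \<mu>) \<sigma> (cls ?L (small_ideal ?L \<mu>) A) =
      cls ?L (small_ideal ?L \<mu>) (f -` A \<inter> ?L)"
    using assms(11) by (auto simp: trivial_aut_def)
  have sel: "\<pi> (cls ?L (small_ideal ?L \<kappa>) A) = cls ?L (small_ideal ?L \<kappa>) (\<sigma> A)" if "A \<subseteq> ?L" for A
    using assms(10) that by (simp add: selector_def)
  have induces: "|sym_diff (\<sigma> B) (f -` A \<inter> ?L)| <o \<mu>"
    if "A \<subseteq> ?L" "B \<subseteq> ?L" "|sym_diff A B| <o \<mu>" for A B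
    using induced_map_cls_eqD[OF assms(2) that(1) range _ ind[OF that(1)] that(2,3)] by blast
  have empty: "|{}| <o \<mu>" using small_empty assms(4) by (meson ordLess_transitive card_of_empty ordLeq_ordLess_trans)
  have induces_self: "|sym_diff (\<sigma> A) (f -` A \<inter> ?L)| <o \<mu>" if "A \<subseteq> ?L" for A
    using induces[OF that that] empty by simp
  \<comment> \<open>\<open>A\<close> represents the same class modulo \<mu> as the empty set, whose
    preimage under \<open>f\<close> is empty.\<close>
  have image_less: "|\<sigma> A| <o \<mu>" if "A \<subseteq> ?L" "|A| <o \<mu>" for A
    using induces[of "{}" A] that by simp
  \<comment> \<open>The two alternatives of the hypothesis enter here: either \<pi> has a
    representative of the image with the size of \<open>A\<close>, or \<mu> is at least
    \<open>cardSuc (cardSuc \<kappa>)\<close> and the scale argument bounds \<open>|A|\<close> by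
    \<open>|\<sigma> A|\<close>.\<close>
  have preimage_less: "|A| <o \<mu>" if A: "A \<subseteq> ?L" "|\<sigma> A| <o \<mu>" for A
    using assms(9)
  proof
    assume "cardinality_preserving ?L (small_ideal ?L \<kappa>) \<pi>"
    then obtain B where B: "B \<subseteq> ?L" "|B| =o |A|"
      "\<pi> (cls ?L (small_ideal ?L \<kappa>) A) = cls ?L (small_ideal ?L \<kappa>) B"
      using A(1) unfolding cardinality_preserving_def by blast
    then have "small (sym_diff (\<sigma> A) B)"
      using cls_eq_iff[OF assms(1) range[OF A(1)] B(1)] sel[OF A(1)] by simp
    then have "|B| <o \<mu>"
      using small_sym_diff_card_less[OF assms(2,4) A(2), of B] by (simp add: Un_commute)
    with ordIso_symmetric[OF B(2)] show ?thesis by (rule ordIso_ordLess_trans)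
  next
    assume *: "cardSuc \<kappa> <o \<mu>"
    have card\<mu>: "Card_order \<mu>" using assms(2) by blast
    have "cardSuc (cardSuc \<kappa>) \<le>o \<mu>"
      using * cardSuc_least[OF cardSuc_Card_order[OF card] card\<mu>] by blast
    show ?thesis
    proof (rule ccontr)
      assume "\<not> ?thesis"
      then have le: "\<mu> \<le>o |A|" using card_not_less_iff[OF card\<mu>] by blast
      with \<open>cardSuc (cardSuc \<kappa>) \<le>o \<mu>\<close> have "cardSuc (cardSuc \<kappa>) \<le>o |A|" by (rule ordLeq_transitive)
      then have "|A| \<le>o |\<sigma> A|" by (rule image_card_geq[OF A(1)])
      with le have "\<mu> \<le>o |\<sigma> A|" by (rule ordLeq_transitive)
      with A(2) show False using not_ordLess_ordLeq by blast
    qed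
  qed
  obtain T D where TD: "T \<subseteq> ?L" "|?L - T| <o \<mu>" "D \<subseteq> ?L" "f \<in> D \<rightarrow> T"
    "\<And>A. A \<subseteq> T \<Longrightarrow> small (sym_diff (\<sigma> A) (f -` A \<inter> D))"
    using trivial_off_small_set[OF assms(2,4) induces_self image_less preimage_less] by blast
  have "\<pi> (cls ?L (small_ideal ?L \<kappa>) A) = cls ?L (small_ideal ?L \<kappa>) (f -` A \<inter> D)"
    if A: "A \<subseteq> T" for A
  proof -
    have AL: "A \<subseteq> ?L" and DL: "f -` A \<inter> D \<subseteq> ?L" using A TD(1,3) by blast+
    show ?thesis using sel[OF AL] cls_eq_iff[OF assms(1) range[OF AL] DL] TD(5)[OF A] by simp
  qed
  then have "trivial_on ?L (small_ideal ?L \<kappa>) \<pi> T" using TD(3,4) unfolding trivial_on_def by blast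
  moreover have "?L = T \<union> (?L - T)" using TD(1) by blast
  ultimately show ?thesis using TD(1,2) unfolding almost_trivial_def by (meson Diff_subset)
qed

end
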